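(* If $\mathrm{P}(\xi^2)$ is a relaxation of $\mathrm{P}(\xi^1)$ for two (distinct) scenarios $\xi^1,\xi^2\in\mathcal{U}$, then $\mathrm{Rec}(\mathcal{U})$ and $\mathrm{Rec}(\mathcal{U}\setminus\{\xi^2\})$ have the same recoverable-robust solutions.
   Context: $\mathcal{X}\subseteq\mathbb{R}^n$ is closed, $\mathcal{U}\subseteq\mathbb{R}^M$ is a closed set with at least two elements, for each $\xi\in\mathcal{U}$ the functions $F(\cdot,\xi):\mathbb{R}^n\to\mathbb{R}^m$ and $f(\cdot,\xi):\mathbb{R}^n\to\mathbb{R}$ are continuous, and $d:\mathbb{R}^n\times\mathbb{R}^n\to\mathbb{R}$ is a metric. $\mathrm{P}(\xi)$ is: minimize $f(x,\xi)$ subject to $F(x,\xi)\le 0$ (componentwise), $x\in\mathcal{X}$. $\mathrm{P}(\xi^2)$ is a relaxation of $\mathrm{P}(\xi^1)$ if every $x\in\mathcal{X}$ with $F(x,\xi^1)\le 0$ satisfies $F(x,\xi^2)\le 0$ and $f(x,\xi^2)\le f(x,\xi^1)$. For a set of scenarios $\mathcal{V}\subseteq\mathcal{U}$, $\mathrm{Rec}(\mathcal{V})$ is the biobjective problem: minimize $(\mathbf{f}_{\mathcal{V}}(y),\mathbf{r}_{\mathcal{V}}(x,y))=\left(\sup_{\xi\in\mathcal{V}}f(y(\xi),\xi),\ \sup_{\xi\in\mathcal{V}}d(x,y(\xi))\right)$ subject to $F(y(\xi),\xi)\le 0$ for all $\xi\in\mathcal{V}$, $x\in\mathcal{X}$,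 $y:\mathcal{V}\to\mathcal{X}$. A feasible $(x,y)$ is Pareto efficient for $\mathrm{Rec}(\mathcal{V})$ if there is no feasible $(x',y')$ with $\mathbf{f}_{\mathcal{V}}(y')\le\mathbf{f}_{\mathcal{V}}(y)$ and $\mathbf{r}_{\mathcal{V}}(x',y')\le\mathbf{r}_{\mathcal{V}}(x,y)$ where at least one of the inequalities is strict. A point $x\in\mathcal{X}$ is a recoverable-robust solution of $\mathrm{Rec}(\mathcal{V})$ if there exists $y:\mathcal{V}\to\mathcal{X}$ such that $(x,y)$ is Pareto efficient for $\mathrm{Rec}(\mathcal{V})$. *)

theory Defs
  imports "HOL-Analysis.Analysis"
begin

text \<open>
  The order on \<^typ>\<open>real^'m\<close> is the componentwise one, so \<open>F x \<xi> \<le> 0\<close> is the system of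
  constraints. The metric \<open>d\<close> is arbitrary and need not be the Euclidean distance.
\<close>

definition scenario_feasible ::
  "(real^'n) set \<Rightarrow> (real^'n \<Rightarrow> real^'k \<Rightarrow> real^'m) \<Rightarrow> real^'k \<Rightarrow> (real^'n) set" where
  "scenario_feasible X F \<xi> = {x \<in> X. F x \<xi> \<le> 0}"

definition is_relaxation ::
  "(real^'n) set \<Rightarrow> (real^'n \<Rightarrow> real^'k \<Rightarrow> real^'m) \<Rightarrow> (real^'n \<Rightarrow> real^'k \<Rightarrow> real) \<Rightarrow>
   real^'k \<Rightarrow> real^'k \<Rightarrow> bool" \<comment> \<open>\<open>P(\<xi>2)\<close> is a relaxation of \<open>P(\<xi>1)\<close>; note the argument order\<close> where
  "is_relaxation X F f \<xi>2 \<xi>1 \<longleftrightarrow>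
     (\<forall>x \<in> scenario_feasible X F \<xi>1. F x \<xi>2 \<le> 0 \<and> f x \<xi>2 \<le> f x \<xi>1)"

text \<open>
  The suprema are taken in the extended reals, since scenario sets may be infinite and
  the objective values unbounded.
\<close>

definition rec_f ::
  "(real^'n \<Rightarrow> real^'k \<Rightarrow> real) \<Rightarrow> (real^'k) set \<Rightarrow> (real^'k \<Rightarrow> real^'n) \<Rightarrow> ereal" where
  "rec_f f V y = (SUP \<xi>\<in>V. ereal (f (y \<xi>) \<xi>))"

definition rec_r ::
  "(real^'n \<Rightarrow> real^'n \<Rightarrow> real) \<Rightarrow> (real^'k) set \<Rightarrow> real^'n \<Rightarrow> (real^'k \<Rightarrow> real^'n) \<Rightarrow> ereal" where
  "rec_r d V x y = (SUP \<xi>\<in>V. ereal (d x (y \<xi>)))"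

definition rec_feasible ::
  "(real^'n) set \<Rightarrow> (real^'n \<Rightarrow> real^'k \<Rightarrow> real^'m) \<Rightarrow> (real^'k) set \<Rightarrow>
   real^'n \<Rightarrow> (real^'k \<Rightarrow> real^'n) \<Rightarrow> bool" where
  "rec_feasible X F V x y \<longleftrightarrow>
     x \<in> X \<and> y \<in> V \<rightarrow>\<^sub>E X \<and> (\<forall>\<xi>\<in>V. F (y \<xi>) \<xi> \<le> 0)"

definition rec_pareto_efficient ::
  "(real^'n) set \<Rightarrow> (real^'n \<Rightarrow> real^'k \<Rightarrow> real^'m) \<Rightarrow> (real^'n \<Rightarrow> real^'k \<Rightarrow> real) \<Rightarrow>
   (real^'n \<Rightarrow> real^'n \<Rightarrow> real) \<Rightarrow> (real^'k) set \<Rightarrow> real^'n \<Rightarrow> (real^'k \<Rightarrow> real^'n) \<Rightarrow> bool" where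
  "rec_pareto_efficient X F f d V x y \<longleftrightarrow>
     rec_feasible X F V x y \<and>
     \<not> (\<exists>x' y'. rec_feasible X F V x' y' \<and>
          rec_f f V y' \<le> rec_f f V y \<and> rec_r d V x' y' \<le> rec_r d V x y \<and>
          (rec_f f V y' < rec_f f V y \<or> rec_r d V x' y' < rec_r d V x y))"

definition recoverable_robust_solutions ::
  "(real^'n) set \<Rightarrow> (real^'n \<Rightarrow> real^'k \<Rightarrow> real^'m) \<Rightarrow> (real^'n \<Rightarrow> real^'k \<Rightarrow> real) \<Rightarrow>
   (real^'n \<Rightarrow> real^'n \<Rightarrow> real) \<Rightarrow> (real^'k) set \<Rightarrow> (real^'n) set" where
  "recoverable_robust_solutions X F f d V =
     {x \<in> X. \<exists>y \<in> V \<rightarrow>\<^sub>E X. rec_pareto_efficient X F f d V x y}"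

end

theory Submission
  imports Defs
begin

text \<open>
  A recovery policy \<open>y\<close> for the scenarios other than \<open>\<xi>2\<close> extends to \<open>\<xi>2\<close> by recovering to \<open>y \<xi>1\<close>,
  which is feasible and no more costly there and so increases neither objective; restricting
  a policy does not increase them either. Hence a dominating point of one problem yields a
  dominating point of the other, with the same first-stage decision.
\<close>

text \<open>\<open>restrict\<close> keeps the policy extensional, as membership in
  \<open>V \<rightarrow>\<^sub>E X\<close> demands: outside \<open>V\<close> its value must be
  \<open>undefined\<close>.\<close>

lemma rec_feasible_restrict:
  assumes "rec_feasible X F U x y" and "V \<subseteq> U"
  shows "rec_feasible X F V x (restrict y V)"
  using assms by (auto simp: rec_feasible_def)

lemma rec_f_restrict_le:
  assumes "V \<subseteq> U"
  shows "rec_f f V (restrict y V) \<le> rec_f f U y"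
  unfolding rec_f_def using assms by (intro SUP_mono) auto

lemma rec_r_restrict_le:
  assumes "V \<subseteq> U"
  shows "rec_r d V x (restrict y V) \<le> rec_r d U x y"
  unfolding rec_r_def using assms by (intro SUP_mono) auto

lemma rec_feasible_extend:
  assumes "rec_feasible X F (U - {\<xi>2}) x y"
    and "\<xi>1 \<in> U - {\<xi>2}" and "\<xi>2 \<in> U" and "is_relaxation X F f \<xi>2 \<xi>1"
  shows "rec_feasible X F U x (y(\<xi>2 := y \<xi>1))"
proof -
  from assms(1,2) have "y \<xi>1 \<in> scenario_feasible X F \<xi>1"
    by (auto simp: rec_feasible_def scenario_feasible_def)
  with assms(4) have "y \<xi>1 \<in> X" "F (y \<xi>1) \<xi>2 \<le> 0"
    by (auto simp: is_relaxation_def scenario_feasible_def)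
  \<comment> \<open>The update leaves the policy extensional on \<open>U\<close> because
    \<open>\<xi>2 \<in> U\<close>.\<close>
  with assms(1,3) show ?thesis
    by (auto simp: rec_feasible_def PiE_iff extensional_def)
qed

lemma rec_f_extend_le:
  assumes "rec_feasible X F (U - {\<xi>2}) x y"
    and "\<xi>1 \<in> U - {\<xi>2}" and "is_relaxation X F f \<xi>2 \<xi>1"
  shows "rec_f f U (y(\<xi>2 := y \<xi>1)) \<le> rec_f f (U - {\<xi>2}) y"
proof -
  from assms(1-3) have le: "f (y \<xi>1) \<xi>2 \<le> f (y \<xi>1) \<xi>1"
    by (auto simp: rec_feasible_def is_relaxation_def scenario_feasible_def)
  \<comment> \<open>The witness \<open>\<eta>\<close> is \<open>\<xi>1\<close> if
    \<open>\<xi> = \<xi>2\<close>, and \<open>\<xi>\<close> itself otherwise.\<close>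
  have "\<exists>\<eta>\<in>U - {\<xi>2}. ereal (f ((y(\<xi>2 := y \<xi>1)) \<xi>) \<xi>) \<le> ereal (f (y \<eta>) \<eta>)" if "\<xi> \<in> U" for \<xi>
    using that le assms(2) by (cases "\<xi> = \<xi>2") auto
  then show ?thesis
    unfolding rec_f_def by (rule SUP_mono)
qed

text \<open>The distance depends on the scenario only through the recovered point, so the term at
  \<open>\<xi>2\<close> merely repeats the one at \<open>\<xi>1\<close>.\<close>

lemma rec_r_extend_le:
  assumes "\<xi>1 \<in> U - {\<xi>2}"
  shows "rec_r d U x (y(\<xi>2 := y \<xi>1)) \<le> rec_r d (U - {\<xi>2}) x y"
  unfolding rec_r_def
proof (rule SUP_mono)
  fix \<xi> assume "\<xi> \<in> U"
  then show "\<exists>\<eta>\<in>U - {\<xi>2}. ereal (d x ((y(\<xi>2 := y \<xi>1)) \<xi>)) \<le> ereal (d x (y \<eta>))"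
    using assms by (cases "\<xi> = \<xi>2") auto
qed

text \<open>A point dominating \<open>(x, z)\<close> for \<open>W\<close> would be pulled back to
  one dominating \<open>(x, y)\<close> for \<open>V\<close>. No inclusion between \<open>V\<close>
  and \<open>W\<close> is fixed, so that both directions of the theorem are instances.\<close>

lemma rec_pareto_efficient_transfer:
  assumes eff: "rec_pareto_efficient X F f d V x y"
    and feas: "rec_feasible X F W x z"
    and le: "rec_f f W z \<le> rec_f f V y" "rec_r d W x z \<le> rec_r d V x y"
    and pull: "\<And>x' z'. rec_feasible X F W x' z' \<Longrightarrow>
      \<exists>y'. rec_feasible X F V x' y' \<and> rec_f f V y' \<le> rec_f f W z' \<and> rec_r d V x' y' \<le> rec_r d W x' z'"
  shows "rec_pareto_efficient X F f d W x z"
  unfolding rec_pareto_efficient_def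
proof (intro conjI feas notI, elim exE conjE)
  fix x' z'
  assume z': "rec_feasible X F W x' z'"
    and dom: "rec_f f W z' \<le> rec_f f W z" "rec_r d W x' z' \<le> rec_r d W x z"
      "rec_f f W z' < rec_f f W z \<or> rec_r d W x' z' < rec_r d W x z"
  from pull[OF z'] obtain y' where y': "rec_feasible X F V x' y'"
    "rec_f f V y' \<le> rec_f f W z'" "rec_r d V x' y' \<le> rec_r d W x' z'"
    by blast
  \<comment> \<open>In each objective the values form a chain \<open>y'\<close> \<le>
    \<open>z'\<close> \<le> \<open>z\<close> \<le> \<open>y\<close>.\<close>
  have "rec_f f V y' \<le> rec_f f V y" "rec_r d V x' y' \<le> rec_r d V x y"
    using y' dom le by (meson order_trans)+
  \<comment> \<open>In the objective where the middle link from \<open>z'\<close> to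
    \<open>z\<close> is strict, the whole chain is strict.\<close>
  moreover have "rec_f f V y' < rec_f f V y \<or> rec_r d V x' y' < rec_r d V x y"
    using y' dom(3) le by (meson order_le_less_trans order_less_le_trans)
  ultimately show False
    using eff y'(1) unfolding rec_pareto_efficient_def by blast
qed

text \<open>Feasibility already contains \<open>x \<in> X\<close> and
  \<open>y \<in> V \<rightarrow>\<^sub>E X\<close>, so witnesses can be exchanged without separate
  membership checks.\<close>

lemma recoverable_robust_solutions_iff:
  "x \<in> recoverable_robust_solutions X F f d V \<longleftrightarrow> (\<exists>y. rec_pareto_efficient X F f d V x y)"
  by (auto simp: recoverable_robust_solutions_def rec_pareto_efficient_def rec_feasible_def)

theorem lemma8:
  fixes X :: "(real^'n) set" and U :: "(real^'k) set"
    and F :: "real^'n \<Rightarrow> real^'k \<Rightarrow> real^'m"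
    and f :: "real^'n \<Rightarrow> real^'k \<Rightarrow> real"
    and d :: "real^'n \<Rightarrow> real^'n \<Rightarrow> real"
    and \<xi>1 \<xi>2 :: "real^'k"
  assumes "closed X"
    and "closed U"
    and "\<exists>a\<in>U. \<exists>b\<in>U. a \<noteq> b"
    and "\<And>\<xi>. \<xi> \<in> U \<Longrightarrow> continuous_on UNIV (\<lambda>x. F x \<xi>)"
    and "\<And>\<xi>. \<xi> \<in> U \<Longrightarrow> continuous_on UNIV (\<lambda>x. f x \<xi>)"
    and "Metric_space UNIV d"
    and "\<xi>1 \<in> U" and "\<xi>2 \<in> U" and "\<xi>1 \<noteq> \<xi>2"
    and "is_relaxation X F f \<xi>2 \<xi>1"
  shows "recoverable_robust_solutions X F f d U =
         recoverable_robust_solutions X F f d (U - {\<xi>2})"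
proof -
  let ?V = "U - {\<xi>2}"
  note relax = \<open>is_relaxation X F f \<xi>2 \<xi>1\<close>
  \<comment> \<open>Distinctness of the scenarios keeps \<open>\<xi>1\<close> available after
    \<open>\<xi>2\<close> is deleted.\<close>
  have \<xi>: "\<xi>1 \<in> ?V" "\<xi>2 \<in> U" and sub: "?V \<subseteq> U"
    using assms by auto
  note restrict = rec_feasible_restrict[OF _ sub] rec_f_restrict_le[OF sub] rec_r_restrict_le[OF sub]
  have extend: "rec_feasible X F U x (y(\<xi>2 := y \<xi>1))"
      "rec_f f U (y(\<xi>2 := y \<xi>1)) \<le> rec_f f ?V y" "rec_r d U x (y(\<xi>2 := y \<xi>1)) \<le> rec_r d ?V x y"
    if "rec_feasible X F ?V x y" for x y
    by (fact rec_feasible_extend[OF that \<xi> relax] rec_f_extend_le[OF that \<xi>(1) relax]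
        rec_r_extend_le[OF \<xi>(1)])+
  \<comment> \<open>From \<open>U\<close> to \<open>?V\<close>: the efficient policy is restricted,
    while competitors are pulled back the opposite way, by extension.\<close>
  have "rec_pareto_efficient X F f d ?V x (restrict y ?V)"
    if eff: "rec_pareto_efficient X F f d U x y" for x y
  proof (rule rec_pareto_efficient_transfer[OF eff])
    show "rec_feasible X F ?V x (restrict y ?V)"
      using eff restrict(1) unfolding rec_pareto_efficient_def by blast
    show "\<exists>y'. rec_feasible X F U x' y' \<and> rec_f f U y' \<le> rec_f f ?V z' \<and> rec_r d U x' y' \<le> rec_r d ?V x' z'"
      if "rec_feasible X F ?V x' z'" for x' z'
      using extend[OF that] by (intro exI conjI)
  qed (rule restrict)+
  \<comment> \<open>From \<open>?V\<close> to \<open>U\<close> the roles swap: the efficient policy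
    is extended and competitors are restricted.\<close>
  moreover have "rec_pareto_efficient X F f d U x (y(\<xi>2 := y \<xi>1))"
    if eff: "rec_pareto_efficient X F f d ?V x y" for x y
  proof -
    have "rec_feasible X F ?V x y"
      using eff unfolding rec_pareto_efficient_def by blast
    note ext = extend[OF this]
    show ?thesis
    proof (rule rec_pareto_efficient_transfer[OF eff ext])
      show "\<exists>y'. rec_feasible X F ?V x' y' \<and> rec_f f ?V y' \<le> rec_f f U z' \<and> rec_r d ?V x' y' \<le> rec_r d U x' z'"
        if "rec_feasible X F U x' z'" for x' z'
        using restrict(1)[OF that] restrict(2,3) by (intro exI conjI)
    qed
  qed
  ultimately show ?thesis
    by (intro set_eqI) (unfold recoverable_robust_solutions_iff, rule iffI; elim exE; rule exI)
qed

end
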